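(* Let $n,k$ be positive integers with $k\le n$. Then $\beta_{[\pm 1]}(n,k)\ge \lceil \log_2 \lceil \frac{n}{\lceil k/2\rceil}\rceil\rceil$. Moreover, if $k$ is even and $k/2$ is odd, then $\beta_{[\pm 1]}(n,k)\ge \log_2(n-k+2)$.
   Context: For a positive integer $n$, $[n]=\{1,\dots,n\}$ and $\binom{[n]}{k}$ is the family of all $k$-element subsets of $[n]$. For a set $D$ of integers and families $\mathcal{F},\mathcal{F}'$ of subsets of $[n]$, $\mathcal{F}'$ is called $D$-secting for $\mathcal{F}$ if for every $A\in\mathcal{F}$ there exists $A'\in\mathcal{F}'$ with $|A\cap A'|-|A\cap([n]\setminus A')|\in D$. $\beta_D(\mathcal{F})$ is the minimum cardinality of a $D$-secting family for $\mathcal{F}$; $\beta_{[\pm 1]}$ denotes $\beta_D$ with $D=\{-1,0,1\}$. $\beta_{[\pm1]}(n,k)$ is the maximum of $\beta_{[\pm1]}(\mathcal{F})$ over all families $\mathcal{F}\subseteq\binom{[n]}{k}$.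
   Formalization: The case k = 1 with n ≥ 3 is excluded: there a single set sects every singleton, so β_{[±1]}(n,1) = 1, while the claimed first bound is ⌈log₂ n⌉ ≥ 2. *)

theory Defs
  imports Complex_Main
begin

definition secting :: "nat \<Rightarrow> int set \<Rightarrow> nat set set \<Rightarrow> nat set set \<Rightarrow> bool" where
  "secting n D F F' \<longleftrightarrow>
     (\<forall>A\<in>F. \<exists>A'\<in>F'. int (card (A \<inter> A')) - int (card (A \<inter> ({1..n} - A'))) \<in> D)"

(* The set under Min is finite; it is nonempty for D = {-1,0,1} and F a family of subsets
   of {1..n}, since then Pow {1..n} is D-secting for F. *)
definition beta :: "nat \<Rightarrow> int set \<Rightarrow> nat set set \<Rightarrow> nat" where
  "beta n D F = Min (card ` {F'. F' \<subseteq> Pow {1..n} \<and> secting n D F F'})"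

definition beta_pm1 :: "nat \<Rightarrow> nat \<Rightarrow> nat" where
  "beta_pm1 n k = Max (beta n {-1,0,1} ` Pow {A. A \<subseteq> {1..n} \<and> card A = k})"

(* A singleton is sected by every set, so a lower bound growing with n fails for k = 1. *)
lemma beta_pm1_one_le: "beta_pm1 n 1 \<le> 1"
proof -
  have "beta n {-1,0,1} F \<le> 1" if F: "F \<subseteq> {A. A \<subseteq> {1..n} \<and> card A = 1}" for F
  proof -
    have "secting n {-1,0,1} F {{}}"
      unfolding secting_def
    proof
      fix A assume "A \<in> F"
      then have "A \<subseteq> {1..n}" "card A = 1" using F by auto
      then have "A \<inter> ({1..n} - {}) = A" by blast
      then show "\<exists>A'\<in>{{}}. int (card (A \<inter> A')) - int (card (A \<inter> ({1..n} - A'))) \<in> {-1,0,1}"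
        using \<open>card A = 1\<close> by simp
    qed
    then have "{{}} \<in> {F'. F' \<subseteq> Pow {1..n} \<and> secting n {-1,0,1} F F'}" by simp
    then have "card {{}::nat set} \<in> card ` {F'. F' \<subseteq> Pow {1..n} \<and> secting n {-1,0,1} F F'}"
      by (rule imageI)
    moreover have "finite {F'. F' \<subseteq> Pow {1..n} \<and> secting n {-1,0,1} F F'}"
      by (rule finite_subset[of _ "Pow (Pow {1..n})"]) auto
    ultimately have "beta n {-1,0,1} F \<le> card {{}::nat set}"
      unfolding beta_def by (intro Min_le finite_imageI)
    then show ?thesis by simp
  qed
  moreover have "finite (Pow {A. A \<subseteq> {1..n} \<and> card A = 1})" by simp
  ultimately show ?thesis
    unfolding beta_pm1_def by (subst Max_le_iff) auto
qed

lemma bound_fails_3_1: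
  "\<not> int (beta_pm1 3 1) \<ge> \<lceil>log 2 (real_of_int \<lceil>real 3 / real_of_int \<lceil>real 1 / 2\<rceil>\<rceil>)\<rceil>"
proof -
  have "\<lceil>real 1 / 2\<rceil> = 1" by (simp add: ceiling_eq_iff)
  moreover have "1 < log 2 (3::real)" by (subst less_log_iff) auto
  then have "1 < \<lceil>log 2 (3::real)\<rceil>" by (simp add: less_ceiling_iff del: one_less_ceiling)
  moreover have "int (beta_pm1 3 1) \<le> 1" using beta_pm1_one_le[of 3] by linarith
  ultimately show ?thesis by (simp del: One_nat_def one_less_ceiling)
qed

end

theory Submission
  imports Defs
begin

text \<open>
  A family of m sets splits the points of [n] into at most 2^m classes according to the members
  of the family containing them. If n > 2^m c with c = \<lceil>k/2\<rceil>, some class has c + 1 points, and a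
  k-set containing them has, for every member of the family, more than c points on one side, so it
  is not sected. If n - k + 2 > 2^m, one can remove k/2 pairs of equivalent points one after
  another; the union of these pairs meets every member in an even number of points, hence never in
  k/2 points when k/2 is odd.
\<close>

text \<open>Any subset of \<open>A\<close> with half its size, rounded down, sects \<open>A\<close>.
  This makes the set under \<open>Min\<close> in \<open>beta\<close> nonempty, so the minimum is
  attained.\<close>

lemma secting_Pow_pm1:
  assumes "F \<subseteq> Pow {1..n}"
  shows "secting n {-1,0,1} F (Pow {1..n})"
  unfolding secting_def
proof
  fix A assume "A \<in> F"
  with assms have A: "A \<subseteq> {1..n}" by blast
  then have "finite A" by (rule finite_subset) simp
  obtain B where B: "B \<subseteq> A" "card B = card A div 2"
    using obtain_subset_with_card_n[of "card A div 2" A] by auto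
  have "A \<inter> B = B" "A \<inter> ({1..n} - B) = A - B" using A B by auto
  moreover have "card (A - B) = card A - card A div 2"
    using B \<open>finite A\<close> by (simp add: card_Diff_subset finite_subset)
  ultimately have "int (card (A \<inter> B)) - int (card (A \<inter> ({1..n} - B))) \<in> {-1,0,1}"
    using B(2) by auto
  then show "\<exists>A'\<in>Pow {1..n}. int (card (A \<inter> A')) - int (card (A \<inter> ({1..n} - A'))) \<in> {-1,0,1}"
    using A B by blast
qed

text \<open>The family of all \<open>k\<close>-sets is among the families under \<open>Max\<close>,
  so a smallest secting family for it has at most \<open>beta_pm1 n k\<close> members. Both bounds
  thus reduce to bounding an arbitrary secting family of all \<open>k\<close>-sets.\<close>

lemma beta_pm1_obtain_secting:
  obtains F' where "F' \<subseteq> Pow {1..n}" "card F' \<le> beta_pm1 n k"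
    "secting n {-1,0,1} {A. A \<subseteq> {1..n} \<and> card A = k} F'"
proof -
  let ?F = "{A. A \<subseteq> {1..n} \<and> card A = k}"
  let ?S = "{F'. F' \<subseteq> Pow {1..n} \<and> secting n {-1,0,1} ?F F'}"
  have "Pow {1..n} \<in> ?S" using secting_Pow_pm1[of ?F n] by auto
  then have "card ` ?S \<noteq> {}" by blast
  moreover have "finite (card ` ?S)"
    by (rule finite_imageI, rule finite_subset[of _ "Pow (Pow {1..n})"]) auto
  ultimately have "beta n {-1,0,1} ?F \<in> card ` ?S"
    unfolding beta_def by (intro Min_in)
  moreover have "beta n {-1,0,1} ?F \<le> beta_pm1 n k"
    unfolding beta_pm1_def by (rule Max_ge) auto
  ultimately show thesis using that by auto
qed

lemma card_Int_complement:
  fixes n :: nat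
  assumes "A \<subseteq> {1..n}"
  shows "int (card (A \<inter> ({1..n} - B))) = int (card A) - int (card (A \<inter> B))"
proof -
  have "A \<inter> ({1..n} - B) = A - B" using assms by blast
  moreover have "finite A" using assms by (rule finite_subset) simp
  then have "card A = card (A \<inter> B) + card (A - B)"
    by (metis card_Int_Diff)
  ultimately show ?thesis by simp
qed

lemma pigeonhole_fiber:
  assumes "finite X" "finite T" "f ` X \<subseteq> T" "card T * c < card X"
  shows "\<exists>t. \<exists>S\<subseteq>{x\<in>X. f x = t}. card S = Suc c"
proof -
  have "\<exists>t\<in>T. c < card {x\<in>X. f x = t}"
  proof (rule ccontr)
    assume *: "\<not> ?thesis"
    have "X = (\<Union>t\<in>T. {x\<in>X. f x = t})" using assms(3) by blast
    then have "card X \<le> (\<Sum>t\<in>T. card {x\<in>X. f x = t})"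
      using card_UN_le[OF assms(2), of "\<lambda>t. {x\<in>X. f x = t}"] by simp
    also have "\<dots> \<le> card T * c"
      using * sum_bounded_above[of T "\<lambda>t. card {x\<in>X. f x = t}" c] by (auto simp: not_less)
    finally show False using assms(4) by simp
  qed
  then show ?thesis by (meson Suc_leI obtain_subset_with_card_n)
qed

text \<open>While more than \<open>card T\<close> points remain, two of them share a value of
  \<open>f\<close> and can be removed as a pair. Before the last removal
  \<open>card X - 2 * (j - 1)\<close> points remain, whence the \<open>+ 2\<close>. The predicate
  \<open>P\<close> sees only values of \<open>f\<close>, so it holds for both points of a pair or
  for neither.\<close>

lemma union_of_pairs_in_fibers:
  assumes "finite X" "finite T" "f ` X \<subseteq> T" "card T + 2 * j < card X + 2"
  shows "\<exists>A\<subseteq>X. card A = 2 * j \<and> (\<forall>P. even (card {x\<in>A. P (f x)}))"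
  using assms(1,3,4)
proof (induction j arbitrary: X)
  case 0
  show ?case by (intro exI[of _ "{}"]) simp
next
  case (Suc j)
  have "card (f ` X) < card X"
    using Suc.prems card_mono[OF assms(2) Suc.prems(2)] by simp
  then have "\<not> inj_on f X" using card_image by fastforce
  then obtain x y where xy: "x \<in> X" "y \<in> X" "x \<noteq> y" "f x = f y"
    unfolding inj_on_def by blast
  have "card (X - {x, y}) = card X - 2"
    using xy by (simp add: card_Diff_subset)
  then have "card T + 2 * j < card (X - {x, y}) + 2" using Suc.prems(3) by simp
  then obtain A where A: "A \<subseteq> X - {x, y}" "card A = 2 * j" "\<And>P. even (card {x\<in>A. P (f x)})"
    using Suc.IH[of "X - {x, y}"] Suc.prems by blast
  have fin: "finite A" using A(1) Suc.prems(1) by (meson finite_Diff finite_subset)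
  have nin: "x \<notin> A" "y \<notin> A" using A by auto
  have "even (card {z \<in> insert x (insert y A). P (f z)})" for P
  proof (cases "P (f x)")
    case True
    then have "{z \<in> insert x (insert y A). P (f z)} = insert x (insert y {z\<in>A. P (f z)})"
      using xy by auto
    then show ?thesis using fin nin xy A(3) by simp
  next
    case False
    then have "{z \<in> insert x (insert y A). P (f z)} = {z\<in>A. P (f z)}"
      using xy by auto
    then show ?thesis using A(3) by simp
  qed
  moreover have "card (insert x (insert y A)) = 2 * Suc j" using fin nin xy A by simp
  ultimately show ?case using A(1) xy by (intro exI[of _ "insert x (insert y A)"]) auto
qed

text \<open>The class of a point is encoded by the set of members of \<open>F'\<close> containing
  it, so \<open>Pow F'\<close> indexes all possible classes.\<close>

lemma card_trace_classes:
  assumes "F' \<subseteq> Pow {1..n::nat}"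
  shows "finite (Pow F')" "card (Pow F') = 2 ^ card F'" "(\<lambda>x. {B\<in>F'. x \<in> B}) ` X \<subseteq> Pow F'"
proof -
  have "finite F'" using assms by (rule finite_subset) simp
  then show "finite (Pow F')" "card (Pow F') = 2 ^ card F'" by (simp_all add: card_Pow)
qed auto

lemma secting_card_bound:
  assumes F': "F' \<subseteq> Pow {1..n}"
    and sec: "secting n {-1,0,1} {A. A \<subseteq> {1..n} \<and> card A = k} F'"
    and k: "2 \<le> k" "k \<le> n"
  shows "n \<le> 2 ^ card F' * ((k + 1) div 2)"
proof (rule ccontr)
  define c where "c = (k + 1) div 2"
  let ?f = "\<lambda>x. {B\<in>F'. x \<in> B}"
  assume "\<not> ?thesis"
  then have "card (Pow F') * c < card {1..n}"
    using card_trace_classes(2)[OF F'] c_def by simp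
  from pigeonhole_fiber[OF finite_atLeastAtMost card_trace_classes(1,3)[OF F'] this]
  obtain t S where S: "S \<subseteq> {x\<in>{1..n}. ?f x = t}" "card S = Suc c" by auto
  \<comment> \<open>This is where \<open>k = 1\<close> fails: there \<open>c = 1\<close>, and two
    equivalent points do not fit into a singleton.\<close>
  have "Suc c \<le> k" using k c_def by linarith
  then obtain A where A: "S \<subseteq> A" "A \<subseteq> {1..n}" "card A = k"
    using exists_subset_between[of S k "{1..n}"] S k by (auto simp: subset_iff)
  have "finite A" using A(2) by (rule finite_subset) simp
  obtain B where B: "B \<in> F'"
    "int (card (A \<inter> B)) - int (card (A \<inter> ({1..n} - B))) \<in> {-1,0,1}"
    using sec A unfolding secting_def by blast
  \<comment> \<open>All points of \<open>S\<close> lie in the same members of \<open>F'\<close>, so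
    \<open>B\<close> cannot split \<open>S\<close>.\<close>
  have "S \<subseteq> B \<or> S \<inter> B = {}" using S(1) B(1) by blast
  then have "S \<subseteq> A \<inter> B \<or> S \<subseteq> A \<inter> ({1..n} - B)" using A S by blast
  then have "Suc c \<le> card (A \<inter> B) \<or> Suc c \<le> card (A \<inter> ({1..n} - B))"
    using S(2) \<open>finite A\<close> by (metis card_mono finite_Int)
  \<comment> \<open>One side has at least \<open>c + 1\<close> points and
    \<open>2 * c \<ge> k\<close>, so the two sides differ by at least
    \<open>2 * (c + 1) - k \<ge> 2\<close>.\<close>
  then show False
    using B(2) card_Int_complement[OF A(2), of B] A(3) c_def by auto
qed

lemma secting_odd_half_card_bound:
  assumes F': "F' \<subseteq> Pow {1..n}"
    and sec: "secting n {-1,0,1} {A. A \<subseteq> {1..n} \<and> card A = k} F'"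
    and k: "even k" "odd (k div 2)"
  shows "n + 2 \<le> 2 ^ card F' + k"
proof (rule ccontr)
  let ?f = "\<lambda>x. {B\<in>F'. x \<in> B}"
  assume "\<not> ?thesis"
  then have "card (Pow F') + 2 * (k div 2) < card {1..n} + 2"
    using card_trace_classes(2)[OF F'] k by simp
  from union_of_pairs_in_fibers[OF finite_atLeastAtMost card_trace_classes(1,3)[OF F'] this]
  obtain A where A: "A \<subseteq> {1..n}" "card A = 2 * (k div 2)" "\<forall>P. even (card {x\<in>A. P (?f x)})"
    by (elim exE conjE)
  have "k = 2 * (k div 2)" using k(1) by simp
  with A(2) have "card A = k" by simp
  obtain B where B: "B \<in> F'"
    "int (card (A \<inter> B)) - int (card (A \<inter> ({1..n} - B))) \<in> {-1,0,1}"
    using sec A(1) \<open>card A = k\<close> unfolding secting_def by blast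
  have "{x\<in>A. B \<in> ?f x} = A \<inter> B" using B(1) by auto
  then have "even (card (A \<inter> B))" using A(3)[rule_format, of "\<lambda>T. B \<in> T"] by simp
  moreover have "2 * int (card (A \<inter> B)) - int k \<in> {-1,0,1}"
    using B(2) card_Int_complement[OF A(1), of B] \<open>card A = k\<close> by auto
  \<comment> \<open>For even \<open>k\<close> the difference is even, so among -1, 0, 1 only 0 is
    possible.\<close>
  then have "card (A \<inter> B) = k div 2" using \<open>k = 2 * (k div 2)\<close> by auto
  ultimately show False using k(2) by simp
qed

text \<open>The case \<open>k = 1\<close> is restricted to \<open>n \<le> 2\<close> because one set
  sects all singletons: \<open>beta_pm1 n 1\<close> is at most 1, while the first bound is the
  ceiling of \<open>log 2 n\<close>, which exceeds 1 for \<open>n \<ge> 3\<close>.\<close>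

theorem theorem4:
  fixes n k :: nat
  assumes "0 < n" and "0 < k" and "k \<le> n"
    and "k = 1 \<longrightarrow> n \<le> 2"
  shows "int (beta_pm1 n k) \<ge> \<lceil>log 2 (real_of_int \<lceil>real n / real_of_int \<lceil>real k / 2\<rceil>\<rceil>)\<rceil>
    \<and> (even k \<and> odd (k div 2) \<longrightarrow> real (beta_pm1 n k) \<ge> log 2 (real n - real k + 2))"
proof -
  obtain F' where F': "F' \<subseteq> Pow {1..n}" "card F' \<le> beta_pm1 n k"
    and sec: "secting n {-1,0,1} {A. A \<subseteq> {1..n} \<and> card A = k} F'"
    by (rule beta_pm1_obtain_secting)
  define c where "c = (k + 1) div 2"
  have pow: "(2::nat) ^ card F' \<le> 2 ^ beta_pm1 n k" using F'(2) by simp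
  have log_le: "log 2 x \<le> real (beta_pm1 n k)" if "0 < x" "x \<le> 2 ^ beta_pm1 n k" for x :: real
    using that by (simp add: log_le_iff powr_realpow)
  have c: "0 < c" "\<lceil>real k / 2\<rceil> = int c"
    unfolding c_def using assms(2) by (simp, linarith)
  have "n \<le> 2 ^ card F' * c"
  proof (cases "k = 1")
    case True
    have "{1} \<in> {A. A \<subseteq> {1..n} \<and> card A = k}" using True assms(1) by auto
    then have "F' \<noteq> {}" using sec unfolding secting_def by blast
    moreover have "finite F'" using F'(1) by (rule finite_subset) simp
    ultimately have "1 \<le> card F'" by (simp add: Suc_le_eq card_gt_0_iff)
    then have "(2::nat) ^ 1 \<le> 2 ^ card F'" by (intro power_increasing) auto
    then show ?thesis using True assms(4) c_def by simp
  next
    case False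
    then show ?thesis using secting_card_bound[OF F'(1) sec] assms c_def by auto
  qed
  also have "\<dots> \<le> 2 ^ beta_pm1 n k * c" using pow by simp
  finally have "real n \<le> 2 ^ beta_pm1 n k * real c"
    by (metis of_nat_le_iff of_nat_mult of_nat_numeral of_nat_power)
  \<comment> \<open>The bound is an integer, so it survives taking the inner ceiling before the
    logarithm.\<close>
  then have "real n / real c \<le> of_int (2 ^ beta_pm1 n k)"
    using c by (simp add: divide_le_eq)
  then have "\<lceil>real n / real c\<rceil> \<le> 2 ^ beta_pm1 n k" by (rule ceiling_le)
  then have "real_of_int \<lceil>real n / real c\<rceil> \<le> 2 ^ beta_pm1 n k"
    by (metis of_int_le_iff of_int_numeral of_int_power)
  moreover have "0 < \<lceil>real n / real c\<rceil>" using assms(1) c by simp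
  ultimately have "log 2 \<lceil>real n / real c\<rceil> \<le> real (beta_pm1 n k)"
    by (intro log_le) auto
  then have "int (beta_pm1 n k) \<ge> \<lceil>log 2 (real_of_int \<lceil>real n / real_of_int \<lceil>real k / 2\<rceil>\<rceil>)\<rceil>"
    using c(2) by (simp add: ceiling_le_iff)
  moreover have "log 2 (real n - real k + 2) \<le> real (beta_pm1 n k)"
    if "even k" "odd (k div 2)"
  proof (rule log_le)
    have "n + 2 \<le> 2 ^ beta_pm1 n k + k"
      using secting_odd_half_card_bound[OF F'(1) sec that] pow by linarith
    then have "real (n + 2) \<le> real (2 ^ beta_pm1 n k + k)" by (simp only: of_nat_le_iff)
    then show "real n - real k + 2 \<le> 2 ^ beta_pm1 n k" by simp
  qed (use assms(3) in simp)
  ultimately show ?thesis by blast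
qed

end
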